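(* Let $\chi\in\psi$ and let $f\in\mathcal{C}(\mathbb{R}^2_+)$ be real-valued. Then for every $(x,y)\in\mathbb{R}^2_+$, every $w>0$ and all $\delta_1>0$, $\delta_2>0$, $$\begin{aligned}|(I_w^{\chi}f)(x,y)-f(x,y)|\le{}&\omega(f,\delta_1,\delta_2)\left[M_0(\chi)\left(1+\frac{1}{2\delta_1w}+\frac{1}{2\delta_2w}+\frac{1}{4\delta_1\delta_2w^2}\right)+\frac{M_{(1,0)}(\chi)}{\delta_1w}\left(1+\frac{1}{2w\delta_2}\right)\right]\\&+\omega(f,\delta_1,\delta_2)\left[\frac{M_{(0,1)}(\chi)}{\delta_2w}\left(1+\frac{1}{2w\delta_1}\right)+\frac{M_{(1,1)}(\chi)}{\delta_1\delta_2w^2}\right].\end{aligned}$$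
   Context: $\mathbb{R}_+=(0,\infty)$, $\mathbb{R}^2_+=\mathbb{R}_+\times\mathbb{R}_+$. $C(\mathbb{R}^2_+)$ is the space of continuous bounded functions on $\mathbb{R}^2_+$. $\mathcal{C}(\mathbb{R}^2_+)$ is the space of bounded log-uniformly continuous functions on $\mathbb{R}^2_+$, where $f$ is log-uniformly continuous if for every $\epsilon>0$ there is $\delta>0$ such that $|f(x,y)-f(u,v)|<\epsilon$ whenever $(x,y),(u,v)\in\mathbb{R}^2_+$ satisfy $(\log x-\log u)^2+(\log y-\log v)^2<\delta^2$. Logarithmic modulus of continuity: for $\delta_1,\delta_2>0$, $$\omega(f,\delta_1,\delta_2)=\sup\{|f(x,y)-f(u,v)|:\ (x,y),(u,v)\in\mathbb{R}^2_+,\ |\log x-\log u|\le\delta_1,\ |\log y-\log v|\le\delta_2\}.$$ Moments. For $\chi\in C(\mathbb{R}^2_+)$ and $p_1,p_2\in\mathbb{N}_0$, the absolute moments are $$M_{(p_1,p_2)}(\chi)=\sup_{(u,v)\in\mathbb{R}^2_+}\sum_{k\in\mathbb{Z}}\sum_{j\in\mathbb{Z}}|\chi(e^{-k}u,e^{-j}v)|\,|k-\log u|^{p_1}|j-\log v|^{p_2},$$ with $M_\eta(\chi)=\max_{p_1+p_2=\eta}M_{(p_1,p_2)}(\chi)$ for $\eta\in\mathbb{N}_0$ (so $M_0(\chi)=M_{(0,0)}(\chi)$). Kernel class. $\psi$ is the class of real-valued $\chi\in C(\mathbb{R}^2_+)$ such that: (K1) $\sum_{k\in\mathbb{Z}}\sum_{j\in\mathbb{Z}}\chi(e^{-k}u,e^{-j}v)=1$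 for every $(u,v)\in\mathbb{R}^2_+$; (K2) $M_2(\chi)<+\infty$ and, for all $p_1,p_2\in\mathbb{N}_0$ with $p_1+p_2=2$, $$\lim_{\gamma\to+\infty}\ \sum\sum_{(k,j)\notin B_\gamma(\log u,\log v)}|\chi(e^{-k}u,e^{-j}v)|\,|k-\log u|^{p_1}|j-\log v|^{p_2}=0$$ uniformly in $(u,v)\in\mathbb{R}^2_+$, where $(k,j)$ ranges over $\mathbb{Z}^2$ and $B_\gamma(a,b)$ is the open Euclidean disc of radius $\gamma$ centred at $(a,b)\in\mathbb{R}^2$. Operator. For $\chi\in\psi$ and $w>0$, the bivariate Kantorovich exponential sampling series of a locally integrable $f:\mathbb{R}^2_+\to\mathbb{R}$ is $$(I_w^{\chi}f)(x,y)=\sum_{k\in\mathbb{Z}}\sum_{j\in\mathbb{Z}}\chi(e^{-k}x^w,e^{-j}y^w)\,w^2\int_{k/w}^{(k+1)/w}\left(\int_{j/w}^{(j+1)/w}f(e^u,e^v)\,dv\right)du,\qquad (x,y)\in\mathbb{R}^2_+,$$ whenever this series converges for every $(x,y)\in\mathbb{R}^2_+$. *)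

theory Defs
  imports "HOL-Analysis.Analysis"
begin

text \<open>
  Functions on the open quadrant are represented as functions on \<^typ>\<open>real \<times> real\<close> of which
  only the values on \<open>quadrant\<close> are ever used. Every double series over the integers is the
  unconditional sum over all pairs \<open>(k, j)\<close>. For nonnegative series this agrees with the iterated
  sum, and the series involving a kernel without absolute values converge absolutely,
  see \<open>kernel_summable\<close> and \<open>kantorovich_summable\<close> below.
\<close>

definition quadrant :: "(real \<times> real) set" where
  "quadrant = {0<..} \<times> {0<..}"

definition bounded_continuous :: "(real \<times> real \<Rightarrow> real) set" where
  "bounded_continuous = {f. continuous_on quadrant f \<and> bounded (f ` quadrant)}"

definition log_uniformly_continuous :: "(real \<times> real \<Rightarrow> real) \<Rightarrow> bool" where
  "log_uniformly_continuous f \<longleftrightarrow>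
     (\<forall>\<epsilon>>0. \<exists>\<delta>>0. \<forall>(x, y)\<in>quadrant. \<forall>(u, v)\<in>quadrant.
        (ln x - ln u)\<^sup>2 + (ln y - ln v)\<^sup>2 < \<delta>\<^sup>2 \<longrightarrow> \<bar>f (x, y) - f (u, v)\<bar> < \<epsilon>)"

definition bounded_log_uniformly_continuous :: "(real \<times> real \<Rightarrow> real) set" where
  "bounded_log_uniformly_continuous =
     {f. log_uniformly_continuous f \<and> bounded (f ` quadrant)}"

text \<open>The supremum is taken in \<^typ>\<open>real\<close>, so it is meaningful for \<open>f\<close> bounded on the quadrant.\<close>

definition log_modulus :: "(real \<times> real \<Rightarrow> real) \<Rightarrow> real \<Rightarrow> real \<Rightarrow> real" where
  "log_modulus f \<delta>1 \<delta>2 =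
     Sup {\<bar>f (x, y) - f (u, v)\<bar> | x y u v. (x, y) \<in> quadrant \<and> (u, v) \<in> quadrant \<and>
            \<bar>ln x - ln u\<bar> \<le> \<delta>1 \<and> \<bar>ln y - ln v\<bar> \<le> \<delta>2}"

definition moment_term ::
  "(real \<times> real \<Rightarrow> real) \<Rightarrow> nat \<Rightarrow> nat \<Rightarrow> real \<Rightarrow> real \<Rightarrow> int \<Rightarrow> int \<Rightarrow> real" where
  "moment_term chi p1 p2 u v k j =
     \<bar>chi (exp (- of_int k) * u, exp (- of_int j) * v)\<bar> *
     \<bar>of_int k - ln u\<bar> ^ p1 * \<bar>of_int j - ln v\<bar> ^ p2"

text \<open>The moments take values in \<^typ>\<open>ennreal\<close>, so that their finiteness is a genuine condition;
  those of order at most 2 are finite for kernels of the class, see \<open>abs_moment_finite\<close>.\<close>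

definition abs_moment :: "nat \<Rightarrow> nat \<Rightarrow> (real \<times> real \<Rightarrow> real) \<Rightarrow> ennreal" where
  "abs_moment p1 p2 chi =
     (SUP (u, v)\<in>quadrant. \<Sum>\<^sub>\<infinity>(k, j)\<in>UNIV. ennreal (moment_term chi p1 p2 u v k j))"

definition abs_moment_order :: "nat \<Rightarrow> (real \<times> real \<Rightarrow> real) \<Rightarrow> ennreal" where
  "abs_moment_order \<eta> chi = Max {abs_moment p1 p2 chi | p1 p2. p1 + p2 = \<eta>}"

definition moment_tail ::
  "(real \<times> real \<Rightarrow> real) \<Rightarrow> nat \<Rightarrow> nat \<Rightarrow> real \<Rightarrow> real \<Rightarrow> real \<Rightarrow> ennreal" where
  "moment_tail chi p1 p2 \<gamma> u v =
     (\<Sum>\<^sub>\<infinity>(k, j)\<in>{(k, j). (of_int k, of_int j) \<notin> ball (ln u, ln v) \<gamma>}.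
        ennreal (moment_term chi p1 p2 u v k j))"

definition kernel_class :: "(real \<times> real \<Rightarrow> real) set" where
  "kernel_class = {chi \<in> bounded_continuous.
     (\<forall>(u, v)\<in>quadrant.
        ((\<lambda>(k::int, j::int). chi (exp (- of_int k) * u, exp (- of_int j) * v)) has_sum 1) UNIV) \<and>
     abs_moment_order 2 chi < \<infinity> \<and>
     (\<forall>p1 p2. p1 + p2 = 2 \<longrightarrow>
        (\<forall>\<epsilon>>0. \<forall>\<^sub>F \<gamma> in at_top. \<forall>(u, v)\<in>quadrant. moment_tail chi p1 p2 \<gamma> u v < ennreal \<epsilon>))}"

definition kantorovich_term ::
  "(real \<times> real \<Rightarrow> real) \<Rightarrow> real \<Rightarrow> (real \<times> real \<Rightarrow> real) \<Rightarrow> real \<Rightarrow> real \<Rightarrow> int \<Rightarrow> int \<Rightarrow> real" where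
  "kantorovich_term chi w f x y k j =
     chi (exp (- of_int k) * x powr w, exp (- of_int j) * y powr w) *
     (w\<^sup>2 * (LINT u:{of_int k / w..(of_int k + 1) / w}|lebesgue.
              (LINT v:{of_int j / w..(of_int j + 1) / w}|lebesgue. f (exp u, exp v))))"

definition kantorovich_series ::
  "(real \<times> real \<Rightarrow> real) \<Rightarrow> real \<Rightarrow> (real \<times> real \<Rightarrow> real) \<Rightarrow> real \<times> real \<Rightarrow> real" where
  "kantorovich_series chi w f = (\<lambda>(x, y). \<Sum>\<^sub>\<infinity>(k, j)\<in>UNIV. kantorovich_term chi w f x y k j)"

lemma moment_term_nonneg: "0 \<le> moment_term chi p1 p2 u v k j"
  by (simp add: moment_term_def)

lemma abs_moment_le_order: "abs_moment p1 p2 chi \<le> abs_moment_order (p1 + p2) chi"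
proof -
  have "{abs_moment q1 q2 chi | q1 q2. q1 + q2 = p1 + p2}
      \<subseteq> (\<lambda>(q1, q2). abs_moment q1 q2 chi) ` ({..p1 + p2} \<times> {..p1 + p2})"
    by (auto simp: image_iff)
  then have "finite {abs_moment q1 q2 chi | q1 q2. q1 + q2 = p1 + p2}"
    by (rule finite_subset) auto
  then show ?thesis
    unfolding abs_moment_order_def by (intro Max_ge) auto
qed

lemma power_prod_le:
  fixes a b :: real
  assumes "0 \<le> a" "0 \<le> b" "p1 + p2 \<le> 2" "1 \<le> a \<or> 1 \<le> b"
  shows "a ^ p1 * b ^ p2 \<le> a\<^sup>2 + b\<^sup>2"
proof -
  have 1: "1 \<le> max a b" using assms by auto
  have "a ^ p1 * b ^ p2 \<le> max a b ^ p1 * max a b ^ p2"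
    using assms by (intro mult_mono power_mono) auto
  also have "\<dots> = max a b ^ (p1 + p2)" by (simp add: power_add)
  also have "\<dots> \<le> (max a b)\<^sup>2" using 1 assms by (intro power_increasing) auto
  also have "\<dots> \<le> a\<^sup>2 + b\<^sup>2" by (auto simp: max_def)
  finally show ?thesis .
qed

lemma abs_moment_finite:
  assumes "chi \<in> kernel_class" "p1 + p2 \<le> 2"
  shows "abs_moment p1 p2 chi < \<infinity>"
proof -
  from assms(1) have "bounded (chi ` quadrant)"
    by (auto simp: kernel_class_def bounded_continuous_def)
  then obtain B where B: "B > 0" "\<And>p. p \<in> quadrant \<Longrightarrow> \<bar>chi p\<bar> \<le> B"
    by (auto simp: bounded_pos)
  have M2: "abs_moment_order 2 chi < \<infinity>" using assms(1) by (auto simp: kernel_class_def)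
  let ?S = "\<lambda>p1 p2 u v. \<Sum>\<^sub>\<infinity>(k, j)\<in>UNIV. ennreal (moment_term chi p1 p2 u v k j)"
  have bnd: "?S p1 p2 u v \<le> ennreal B * 9 + (abs_moment 2 0 chi + abs_moment 0 2 chi)"
    if uv: "(u, v) \<in> quadrant" for u v
  proof -
    define a b where "a = ln u" and "b = ln v"
    define F :: "(int \<times> int) set" where "F = {\<lceil>a\<rceil> - 1..\<lceil>a\<rceil> + 1} \<times> {\<lceil>b\<rceil> - 1..\<lceil>b\<rceil> + 1}"
    have finF: "finite F" and cF: "card F = 9" by (simp_all add: F_def card_cartesian_product)
    have in_q: "(exp (- of_int k) * u, exp (- of_int j) * v) \<in> quadrant" for k j :: int
      using uv by (auto simp: quadrant_def)
    have pt: "(case p of (k, j) \<Rightarrow> ennreal (moment_term chi p1 p2 u v k j))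
       \<le> ennreal B * indicator F p +
          ((case p of (k, j) \<Rightarrow> ennreal (moment_term chi 2 0 u v k j)) +
           (case p of (k, j) \<Rightarrow> ennreal (moment_term chi 0 2 u v k j)))" for p
    proof (cases p)
      case (Pair k j)
      define c where "c = \<bar>chi (exp (- of_int k) * u, exp (- of_int j) * v)\<bar>"
      have c: "0 \<le> c" "c \<le> B" using B(2)[OF in_q] by (simp_all add: c_def)
      have real: "moment_term chi p1 p2 u v k j
        \<le> B * indicator F p + (moment_term chi 2 0 u v k j + moment_term chi 0 2 u v k j)"
      proof (cases "1 \<le> \<bar>of_int k - a\<bar> \<or> 1 \<le> \<bar>of_int j - b\<bar>")
        case True
        have "\<bar>of_int k - a\<bar> ^ p1 * \<bar>of_int j - b\<bar> ^ p2 \<le> \<bar>of_int k - a\<bar>\<^sup>2 + \<bar>of_int j - b\<bar>\<^sup>2"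
          using True assms by (intro power_prod_le) auto
        from mult_left_mono[OF this c(1)]
        have "moment_term chi p1 p2 u v k j \<le> moment_term chi 2 0 u v k j + moment_term chi 0 2 u v k j"
          unfolding moment_term_def c_def a_def b_def by (simp add: algebra_simps)
        moreover have "0 \<le> B * indicator F p" using B(1) by simp
        ultimately show ?thesis by simp
      next
        case False
        then have "p \<in> F" unfolding Pair F_def by (auto; linarith)
        moreover have "c * (\<bar>of_int k - a\<bar> ^ p1 * \<bar>of_int j - b\<bar> ^ p2) \<le> B * 1"
          using False c by (intro mult_mono mult_le_one power_le_one) auto
        ultimately show ?thesis
          using add_nonneg_nonneg[OF moment_term_nonneg moment_term_nonneg, of chi 2 0 u v k j chi 0 2 u v k j]
          by (simp add: c_def moment_term_def[of chi p1 p2] a_def b_def mult.assoc)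
      qed
      have "ennreal B * indicator F p = ennreal (B * indicator F p)"
        by (simp add: indicator_def)
      with real B(1) show ?thesis
        by (simp add: Pair moment_term_nonneg ennreal_leI flip: ennreal_plus)
    qed
    have sF: "(\<Sum>\<^sub>\<infinity>p\<in>UNIV. ennreal B * indicator F p) = ennreal B * 9"
    proof -
      have "(\<Sum>\<^sub>\<infinity>p\<in>UNIV. ennreal B * indicator F p) = (\<Sum>\<^sub>\<infinity>p\<in>F. ennreal B)"
        by (rule infsum_cong_neutral) auto
      also have "\<dots> = ennreal B * 9" using finF cF by (simp add: mult.commute)
      finally show ?thesis .
    qed
    have "?S p1 p2 u v \<le> (\<Sum>\<^sub>\<infinity>p\<in>UNIV. ennreal B * indicator F p +
          ((case p of (k, j) \<Rightarrow> ennreal (moment_term chi 2 0 u v k j)) +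
           (case p of (k, j) \<Rightarrow> ennreal (moment_term chi 0 2 u v k j))))"
      by (intro infsum_mono nonneg_summable_on_complete pt) simp_all
    also have "\<dots> = ennreal B * 9 + (?S 2 0 u v + ?S 0 2 u v)"
      by (simp add: infsum_add nonneg_summable_on_complete sF)
    also have "\<dots> \<le> ennreal B * 9 + (abs_moment 2 0 chi + abs_moment 0 2 chi)"
      unfolding abs_moment_def
      by (intro add_mono order_refl) (rule SUP_upper2[OF uv], simp)+
    finally show ?thesis .
  qed
  have "abs_moment p1 p2 chi \<le> ennreal B * 9 + (abs_moment 2 0 chi + abs_moment 0 2 chi)"
    unfolding abs_moment_def[of p1 p2] by (rule SUP_least) (use bnd in auto)
  also have "\<dots> < \<infinity>"
  proof -
    have "abs_moment 2 0 chi < \<infinity>" "abs_moment 0 2 chi < \<infinity>"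
      using le_less_trans[OF abs_moment_le_order[of 2 0 chi, unfolded add_0_right] M2]
        le_less_trans[OF abs_moment_le_order[of 0 2 chi, unfolded add_0] M2] by simp_all
    then show ?thesis by (simp add: ennreal_mult_less_top)
  qed
  finally show ?thesis .
qed

lemma kernel_summable:
  assumes "chi \<in> kernel_class" "(u, v) \<in> quadrant"
  shows "(\<lambda>(k::int, j::int). \<bar>chi (exp (- of_int k) * u, exp (- of_int j) * v)\<bar>) summable_on UNIV"
proof (rule nonneg_bounded_partial_sums_imp_summable_on)
  let ?g = "\<lambda>(k::int, j::int). \<bar>chi (exp (- of_int k) * u, exp (- of_int j) * v)\<bar>"
  have fin: "abs_moment 0 0 chi < \<infinity>" using abs_moment_finite[OF assms(1), of 0 0] by simp
  show "\<forall>\<^sub>F F in finite_subsets_at_top UNIV. sum ?g F \<le> enn2real (abs_moment 0 0 chi)"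
  proof (rule eventually_finite_subsets_at_top_weakI)
    fix F :: "(int \<times> int) set" assume F: "finite F"
    have "ennreal (sum ?g F) = (\<Sum>p\<in>F. ennreal (?g p))"
      by (subst sum_ennreal) auto
    also have "\<dots> \<le> (\<Sum>\<^sub>\<infinity>p\<in>UNIV. ennreal (?g p))"
      unfolding infsum_finite[OF F, symmetric]
      by (rule infsum_mono_neutral) (simp_all add: nonneg_summable_on_complete)
    also have "\<dots> \<le> abs_moment 0 0 chi"
      unfolding abs_moment_def
      by (rule SUP_upper2[OF assms(2)]) (auto simp: moment_term_def split_def)
    finally have "ennreal (sum ?g F) \<le> abs_moment 0 0 chi" .
    from enn2real_mono[OF this] show "sum ?g F \<le> enn2real (abs_moment 0 0 chi)"
      using fin by (simp add: sum_nonneg split_def)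
  qed
qed auto

lemma kantorovich_summable:
  assumes "chi \<in> kernel_class" "bounded (f ` quadrant)" "w > 0" "(x, y) \<in> quadrant"
  shows "(\<lambda>(k, j). kantorovich_term chi w f x y k j) summable_on UNIV"
proof -
  obtain C where C: "C > 0" "\<And>p. p \<in> quadrant \<Longrightarrow> \<bar>f p\<bar> \<le> C"
    using assms(2) by (auto simp: bounded_pos)
  have set_bnd: "\<bar>LINT t:{a..a + d}|lebesgue. g t\<bar> \<le> K * d"
    if "\<And>t. \<bar>g t\<bar> \<le> K" "0 \<le> d" "0 \<le> K" for g :: "real \<Rightarrow> real" and a d K
  proof (cases "set_integrable lebesgue {a..a + d} g")
    case True
    have "\<bar>LINT t:{a..a + d}|lebesgue. g t\<bar> \<le> (LINT t:{a..a + d}|lebesgue. \<bar>g t\<bar>)"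
      using set_integral_norm_bound[OF True] by simp
    also have "\<dots> \<le> (LINT t:{a..a + d}|lebesgue. K)"
      using that by (intro set_integral_mono set_integrable_abs[OF True])
        (auto simp: set_integrable_def)
    also have "\<dots> = K * d"
      using that by (simp add: set_lebesgue_integral_def)
    finally show ?thesis .
  next
    case False
    then show ?thesis using that
      by (simp add: set_lebesgue_integral_def set_integrable_def not_integrable_integral_eq)
  qed
  let ?I = "\<lambda>k j::int. LINT u:{of_int k / w..(of_int k + 1) / w}|lebesgue.
              (LINT v:{of_int j / w..(of_int j + 1) / w}|lebesgue. f (exp u, exp v))"
  have I: "\<bar>?I k j\<bar> \<le> C * (1 / w) * (1 / w)" for k j
    unfolding add_divide_distrib
    by (intro set_bnd) (use C assms(3) in \<open>auto simp: quadrant_def\<close>)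
  have q: "(x powr w, y powr w) \<in> quadrant" using assms(4) by (auto simp: quadrant_def)
  let ?g = "\<lambda>(k::int, j::int). \<bar>chi (exp (- of_int k) * x powr w, exp (- of_int j) * y powr w)\<bar>"
  have "(\<lambda>p. ?g p * C) summable_on UNIV"
    by (intro summable_on_cmult_left kernel_summable[OF assms(1) q])
  then have "(\<lambda>p. norm (case p of (k, j) \<Rightarrow> kantorovich_term chi w f x y k j)) summable_on UNIV"
  proof (rule Infinite_Sum.abs_summable_on_comparison_test')
    fix p :: "int \<times> int"
    obtain k j where p: "p = (k, j)" by (cases p)
    have "w\<^sup>2 * \<bar>?I k j\<bar> \<le> w\<^sup>2 * (C * (1 / w) * (1 / w))"
      by (intro mult_left_mono I) simp
    also have "\<dots> = C" using assms(3) by (simp add: power2_eq_square)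
    finally show "norm (case p of (k, j) \<Rightarrow> kantorovich_term chi w f x y k j) \<le> ?g p * C"
      unfolding p kantorovich_term_def by (auto simp: abs_mult intro!: mult_left_mono)
  qed
  then show ?thesis by (rule abs_summable_summable)
qed

end

theory Submission
  imports Defs
begin

text \<open>
  In logarithmic coordinates \<open>s = ln u\<close>, \<open>t = ln v\<close> the function \<open>f\<close> becomes a bounded uniformly
  continuous function on the plane, and the modulus of continuity becomes the usual one with
  respect to coordinatewise steps of size \<open>\<delta>1\<close> and \<open>\<delta>2\<close>. Cutting the segment between two points
  into equal pieces (\<open>log_modulus_dilation\<close>) shows that the variation of \<open>f\<close> exceeds one modulus
  at most by the factor \<open>(1 + \<bar>s - a\<bar> / \<delta>1) * (1 + \<bar>t - b\<bar> / \<delta>2)\<close>,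
  where \<open>a = ln x\<close> and \<open>b = ln y\<close>. This is a \<^emph>\<open>product\<close> of one-variable factors, so the iterated
  integral mean in each Kantorovich coefficient can be compared with \<open>f (x, y)\<close> one variable at a time: averaging \<open>1 + \<bar>t - b\<bar> / \<delta>\<close> over the cell
  \<open>[j / w, (j + 1) / w]\<close> costs \<open>\<bar>j - w * b\<bar> / (\<delta> * w)\<close> for the distance of the left endpoint and
  \<open>1 / (2 * \<delta> * w)\<close> for the mean distance inside the cell (\<open>cell_mean_deviation\<close>).

  Since the kernel values sum to 1, the error of the operator is the kernel sum of the deviations
  of these means. Expanding the product of the two one-variable bounds gives four terms, whose kernel
  sums are controlled by the absolute moments of orders (0,0), (1,0), (0,1) and (1,1).
\<close>

section \<open>The logarithmic modulus of continuity\<close>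

lemma log_modulus_upper:
  assumes "bounded (f ` quadrant)" "(x, y) \<in> quadrant" "(u, v) \<in> quadrant"
    and "\<bar>ln x - ln u\<bar> \<le> \<delta>1" "\<bar>ln y - ln v\<bar> \<le> \<delta>2"
  shows "\<bar>f (x, y) - f (u, v)\<bar> \<le> log_modulus f \<delta>1 \<delta>2"
proof -
  obtain C where C: "\<And>p. p \<in> quadrant \<Longrightarrow> \<bar>f p\<bar> \<le> C"
    using assms(1) by (auto simp: bounded_iff)
  have "\<bar>f p - f q\<bar> \<le> C + C" if "p \<in> quadrant" "q \<in> quadrant" for p q
    using C[OF that(1)] C[OF that(2)] by linarith
  then show ?thesis
    unfolding log_modulus_def using assms
    by (intro cSup_upper bdd_aboveI[where M = "C + C"]) blast+
qed

lemma log_modulus_nonneg: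
  assumes "bounded (f ` quadrant)" "0 \<le> \<delta>1" "0 \<le> \<delta>2"
  shows "0 \<le> log_modulus f \<delta>1 \<delta>2"
  using log_modulus_upper[OF assms(1), of 1 1 1 1 \<delta>1 \<delta>2] assms by (simp add: quadrant_def)

text \<open>
  Both coordinates are advanced simultaneously along a segment, so the number of pieces is governed
  by the larger of the two ratios, and \<open>1 + max p q \<le> (1 + p) * (1 + q)\<close>. The product is
  coarser than the maximum, but it separates the variables.
\<close>

lemma log_modulus_dilation:
  assumes f: "bounded (f ` quadrant)" and \<delta>: "\<delta>1 > 0" "\<delta>2 > 0"
  shows "\<bar>f (exp s, exp t) - f (exp a, exp b)\<bar>
    \<le> log_modulus f \<delta>1 \<delta>2 * (1 + \<bar>s - a\<bar> / \<delta>1) * (1 + \<bar>t - b\<bar> / \<delta>2)"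
proof -
  define p q where "p = \<bar>s - a\<bar> / \<delta>1" and "q = \<bar>t - b\<bar> / \<delta>2"
  have pq: "0 \<le> p" "0 \<le> q" using \<delta> by (simp_all add: p_def q_def)
  \<comment> \<open>Taking the floor plus one, rather than the ceiling, keeps the number of pieces positive.\<close>
  define n where "n = Suc (nat \<lfloor>max p q\<rfloor>)"
  have n: "max p q \<le> n" "n \<le> 1 + max p q" "0 < n"
    using pq unfolding n_def by linarith+
  define z where "z i = f (exp (a + i * ((s - a) / n)), exp (b + i * ((t - b) / n)))" for i :: nat
  have step: "\<bar>z (Suc i) - z i\<bar> \<le> log_modulus f \<delta>1 \<delta>2" for i
  proof -
    have "\<bar>s - a\<bar> \<le> \<delta>1 * n" "\<bar>t - b\<bar> \<le> \<delta>2 * n"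
      using n(1) \<delta> by (auto simp: p_def q_def field_simps)
    then have "\<bar>s - a\<bar> / n \<le> \<delta>1" "\<bar>t - b\<bar> / n \<le> \<delta>2"
      using n(3) by (simp_all add: field_simps)
    moreover have "a + Suc i * ((s - a) / n) - (a + i * ((s - a) / n)) = (s - a) / n"
        "b + Suc i * ((t - b) / n) - (b + i * ((t - b) / n)) = (t - b) / n"
      by (simp_all add: ring_distribs add_divide_distrib diff_divide_distrib)
    ultimately show ?thesis
      unfolding z_def using n(3)
      by (intro log_modulus_upper f) (simp_all only: ln_exp abs_divide abs_of_nat, auto simp: quadrant_def)
  qed
  have "f (exp s, exp t) - f (exp a, exp b) = z n - z 0"
    using n(3) by (simp add: z_def)
  also have "\<dots> = (\<Sum>i<n. z (Suc i) - z i)"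
    by (simp only: sum_lessThan_telescope)
  finally have "\<bar>f (exp s, exp t) - f (exp a, exp b)\<bar> \<le> (\<Sum>i<n. \<bar>z (Suc i) - z i\<bar>)"
    by (simp only: sum_abs)
  also have "\<dots> \<le> n * log_modulus f \<delta>1 \<delta>2"
    using sum_bounded_above[of "{..<n}", OF step] by simp
  also have "\<dots> \<le> ((1 + p) * (1 + q)) * log_modulus f \<delta>1 \<delta>2"
  proof (rule mult_right_mono)
    have "max p q \<le> p + q + p * q" using pq by (auto simp: max_def add_increasing)
    then show "real n \<le> (1 + p) * (1 + q)"
      using n(2) by (simp only: ring_distribs mult_1 mult_1_right)
  qed (use f \<delta> in \<open>simp add: log_modulus_nonneg\<close>)
  finally show ?thesis by (simp add: p_def q_def mult_ac)
qed

lemma log_uniformly_continuous_imp_continuous_exp: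
  assumes "log_uniformly_continuous f"
  shows "continuous_on UNIV (\<lambda>(s, t). f (exp s, exp t))"
proof -
  have "\<exists>d>0. \<forall>p'\<in>UNIV. dist p' p < d \<longrightarrow>
      dist (f (exp (fst p'), exp (snd p'))) (f (exp (fst p), exp (snd p))) < e"
    if e: "e > 0" for e :: real and p :: "real \<times> real"
  proof -
    from assms[unfolded log_uniformly_continuous_def, THEN spec, THEN mp, OF e]
    obtain d where d: "d > 0" "\<forall>(x, y)\<in>quadrant. \<forall>(u, v)\<in>quadrant.
        (ln x - ln u)\<^sup>2 + (ln y - ln v)\<^sup>2 < d\<^sup>2 \<longrightarrow> \<bar>f (x, y) - f (u, v)\<bar> < e"
      by (elim exE conjE)
    show ?thesis
    proof (intro exI[of _ d] conjI ballI impI d(1))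
      fix p' :: "real \<times> real" assume "dist p' p < d"
      from power_strict_mono[OF this, of 2]
      have less: "(fst p' - fst p)\<^sup>2 + (snd p' - snd p)\<^sup>2 < d\<^sup>2"
        by (simp add: dist_prod_def dist_real_def)
      have q: "(exp (fst p), exp (snd p)) \<in> quadrant" for p :: "real \<times> real"
        by (simp add: quadrant_def)
      from bspec[OF bspec[OF d(2) q, unfolded prod.case] q, unfolded prod.case, of p' p] less
      show "dist (f (exp (fst p'), exp (snd p'))) (f (exp (fst p), exp (snd p))) < e"
        by (simp add: dist_real_def)
    qed
  qed
  then show ?thesis
    unfolding continuous_on_iff split_def by blast
qed

section \<open>Means over a cell\<close>

lemma cell_integral_eq_integral:
  fixes h :: "real \<Rightarrow> real"
  assumes "continuous_on {c..d} h"
  shows "(LINT t:{c..d}|lebesgue. h t) = integral {c..d} h"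
  using absolutely_integrable_continuous[of c d h] assms
  by (intro set_lebesgue_integral_eq_integral) simp_all

text \<open>
  Inside the cell \<open>\<bar>t - a\<bar>\<close> is at most the distance of \<open>a\<close> from the left endpoint plus \<open>t - k / w\<close>,
  whose mean is \<open>1 / (2 * w)\<close>. The factor \<open>K\<close> may depend on another variable, and then the conclusion
  is again a bound of the assumed form in that variable: this is how the two nested means of a
  coefficient are handled by the same argument.
\<close>

lemma cell_mean_deviation:
  fixes h :: "real \<Rightarrow> real"
  assumes h: "continuous_on UNIV h" and w: "w > 0" and \<delta>: "\<delta> > 0" and K: "0 \<le> K"
    and dev: "\<And>t. \<bar>h t - c\<bar> \<le> K * (1 + \<bar>t - a\<bar> / \<delta>)"
  shows "\<bar>w * (LINT t:{k / w..(k + 1) / w}|lebesgue. h t) - c\<bar>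
    \<le> K * (1 + (\<bar>k - w * a\<bar> + 1 / 2) / (\<delta> * w))"
proof -
  define l r where "l = k / w" and "r = (k + 1) / w"
  have lr: "l \<le> r" and len: "r - l = 1 / w"
    using w by (simp_all add: l_def r_def field_simps)
  have "l - a = (k - w * a) / w" using w by (simp add: l_def field_simps)
  then have dist_l: "\<bar>l - a\<bar> = \<bar>k - w * a\<bar> / w" using w by simp
  have h': "continuous_on {l..r} h" using h by (rule continuous_on_subset) simp
  have int: "(\<lambda>t. h t - c) integrable_on {l..r}"
    by (intro integrable_continuous_real continuous_intros h')
  have "((\<lambda>t. t - l) has_integral (r\<^sup>2 / 2 - l * r) - (l\<^sup>2 / 2 - l * l)) {l..r}"
    by (rule fundamental_theorem_of_calculus[OF lr])
       (auto intro!: derivative_eq_intros simp flip: has_real_derivative_iff_has_vector_derivative)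
  also have "(r\<^sup>2 / 2 - l * r) - (l\<^sup>2 / 2 - l * l) = (r - l)\<^sup>2 / 2"
    by (simp add: power2_eq_square field_simps)
  finally have id_int: "((\<lambda>t. t - l) has_integral (1 / w)\<^sup>2 / 2) {l..r}" by (simp add: len)
  have "((\<lambda>t. 1 + \<bar>l - a\<bar> / \<delta>) has_integral (1 + \<bar>l - a\<bar> / \<delta>) * (1 / w)) {l..r}"
    using has_integral_const_real[of "1 + \<bar>l - a\<bar> / \<delta>" l r] lr len by (simp add: mult.commute)
  from has_integral_mult_right[OF has_integral_add[OF this has_integral_divide[OF id_int, of \<delta>]], of K]
  have bound_int: "((\<lambda>t. K * (1 + \<bar>l - a\<bar> / \<delta> + (t - l) / \<delta>)) has_integral
      K * ((1 + \<bar>l - a\<bar> / \<delta>) * (1 / w) + (1 / w)\<^sup>2 / 2 / \<delta>)) {l..r}" .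
  have "\<bar>integral {l..r} (\<lambda>t. h t - c)\<bar>
      \<le> integral {l..r} (\<lambda>t. K * (1 + \<bar>l - a\<bar> / \<delta> + (t - l) / \<delta>))"
  proof (rule integral_norm_bound_integral[OF int, unfolded real_norm_def])
    fix t assume t: "t \<in> {l..r}"
    have "\<bar>t - a\<bar> / \<delta> \<le> (\<bar>l - a\<bar> + (t - l)) / \<delta>"
      using t \<delta> by (intro divide_right_mono) auto
    then have "K * (1 + \<bar>t - a\<bar> / \<delta>) \<le> K * (1 + \<bar>l - a\<bar> / \<delta> + (t - l) / \<delta>)"
      using K by (intro mult_left_mono) (simp_all add: add_divide_distrib)
    with dev[of t] show "\<bar>h t - c\<bar> \<le> K * (1 + \<bar>l - a\<bar> / \<delta> + (t - l) / \<delta>)" by linarith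
  qed (use bound_int in blast)
  also have "\<dots> = K * ((1 + \<bar>l - a\<bar> / \<delta>) * (1 / w) + (1 / w)\<^sup>2 / 2 / \<delta>)"
    using bound_int by (rule integral_unique)
  finally have "w * \<bar>integral {l..r} (\<lambda>t. h t - c)\<bar>
      \<le> w * (K * ((1 + \<bar>l - a\<bar> / \<delta>) * (1 / w) + (1 / w)\<^sup>2 / 2 / \<delta>))"
    using w by (simp add: mult_left_mono)
  also have "\<dots> = K * (1 + (\<bar>k - w * a\<bar> + 1 / 2) / (\<delta> * w))"
    unfolding dist_l using w \<delta> by (simp add: field_simps power2_eq_square)
  also have "w * \<bar>integral {l..r} (\<lambda>t. h t - c)\<bar> = \<bar>w * integral {l..r} h - c\<bar>"
  proof -
    have "integral {l..r} (\<lambda>t. h t - c) = integral {l..r} h - c * (1 / w)"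
      using lr len integrable_continuous_real[OF h']
      by (subst Henstock_Kurzweil_Integration.integral_diff) (simp_all add: mult.commute integrable_const_ivl)
    then have "w * integral {l..r} (\<lambda>t. h t - c) = w * integral {l..r} h - c"
      using w by (simp add: field_simps)
    then show ?thesis using w by (metis abs_mult abs_of_pos)
  qed
  finally show ?thesis
    by (simp add: cell_integral_eq_integral[OF h', unfolded l_def r_def] l_def r_def)
qed

lemma iterated_cell_mean_deviation:
  fixes g :: "real \<times> real \<Rightarrow> real"
  assumes g: "continuous_on UNIV g" and w: "w > 0" and \<delta>: "\<delta>1 > 0" "\<delta>2 > 0" and K: "0 \<le> K"
    and dev: "\<And>s t. \<bar>g (s, t) - c\<bar> \<le> K * (1 + \<bar>s - a\<bar> / \<delta>1) * (1 + \<bar>t - b\<bar> / \<delta>2)"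
  shows "\<bar>w\<^sup>2 * (LINT s:{k / w..(k + 1) / w}|lebesgue. (LINT t:{j / w..(j + 1) / w}|lebesgue. g (s, t))) - c\<bar>
    \<le> K * (1 + (\<bar>k - w * a\<bar> + 1 / 2) / (\<delta>1 * w)) * (1 + (\<bar>j - w * b\<bar> + 1 / 2) / (\<delta>2 * w))"
    (is "_ \<le> K * ?P * ?Q")
proof -
  define G where "G s = w * (LINT t:{j / w..(j + 1) / w}|lebesgue. g (s, t))" for s
  have slice: "continuous_on T (\<lambda>t. g (s, t))" for s T
    by (rule continuous_on_compose2[OF g]) (auto intro: continuous_on_Pair)
  have "\<bar>G s - c\<bar> \<le> K * (1 + \<bar>s - a\<bar> / \<delta>1) * ?Q" for s
    unfolding G_def using K \<delta> by (intro cell_mean_deviation slice w dev) auto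
  then have G_dev: "\<bar>G s - c\<bar> \<le> (K * ?Q) * (1 + \<bar>s - a\<bar> / \<delta>1)" for s
    by (simp add: mult_ac)
  have "continuous_on UNIV (\<lambda>s. integral (cbox (j / w) ((j + 1) / w)) (\<lambda>t. g (s, t)))"
    using g by (intro integral_continuous_on_param) (auto simp: split_def intro: continuous_on_subset)
  then have G_cont: "continuous_on UNIV G"
    unfolding G_def by (simp add: cell_integral_eq_integral[OF slice] continuous_on_mult_left)
  have "w\<^sup>2 * (LINT s:{k / w..(k + 1) / w}|lebesgue. (LINT t:{j / w..(j + 1) / w}|lebesgue. g (s, t)))
      = w * (LINT s:{k / w..(k + 1) / w}|lebesgue. G s)"
    by (simp add: G_def power2_eq_square)
  moreover have "\<bar>w * (LINT s:{k / w..(k + 1) / w}|lebesgue. G s) - c\<bar> \<le> (K * ?Q) * ?P"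
    using K \<delta> w by (intro cell_mean_deviation G_cont G_dev) auto
  ultimately show ?thesis by (simp add: mult_ac)
qed

section \<open>Moment sums of the kernel\<close>

text \<open>
  The moments are suprema of sums of extended reals. Since they are finite up to order 2, each of
  the sums is that of a convergent real series, whose finite partial sums are bounded by the real
  value of the moment.
\<close>

lemma moment_has_sum_le:
  assumes "chi \<in> kernel_class" "p1 + p2 \<le> 2" "(u, v) \<in> quadrant"
  obtains m where "((\<lambda>(k, j). moment_term chi p1 p2 u v k j) has_sum m) UNIV"
    and "m \<le> enn2real (abs_moment p1 p2 chi)"
proof -
  let ?g = "\<lambda>(k, j). moment_term chi p1 p2 u v k j"
  have fin: "abs_moment p1 p2 chi < \<infinity>" using abs_moment_finite[OF assms(1,2)] .
  have part: "sum ?g F \<le> enn2real (abs_moment p1 p2 chi)" if F: "finite F" for F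
  proof -
    have "ennreal (sum ?g F) = (\<Sum>p\<in>F. ennreal (?g p))"
      by (subst sum_ennreal) (auto simp: moment_term_nonneg)
    also have "\<dots> \<le> (\<Sum>\<^sub>\<infinity>p\<in>UNIV. ennreal (?g p))"
      unfolding infsum_finite[OF F, symmetric]
      by (rule infsum_mono_neutral) (simp_all add: nonneg_summable_on_complete)
    also have "\<dots> \<le> abs_moment p1 p2 chi"
      unfolding abs_moment_def by (rule SUP_upper2[OF assms(3)]) (auto simp: split_def)
    finally have "ennreal (sum ?g F) \<le> abs_moment p1 p2 chi" .
    from enn2real_mono[OF this] fin show ?thesis
      by (simp add: sum_nonneg split_def moment_term_nonneg)
  qed
  have "?g summable_on UNIV"
    by (rule nonneg_bounded_partial_sums_imp_summable_on
          [where C = "enn2real (abs_moment p1 p2 chi)"])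
       (auto simp: moment_term_nonneg intro!: eventually_finite_subsets_at_top_weakI part)
  then show ?thesis
    by (intro that[of "infsum ?g UNIV"] has_sum_infsum infsum_le_finite_sums part)
qed

lemma abs_moment_order_0: "abs_moment_order 0 chi = abs_moment 0 0 chi"
  by (simp add: abs_moment_order_def)

section \<open>The quantitative estimate\<close>

theorem theorem3p3:
  fixes chi f :: "real \<times> real \<Rightarrow> real" and x y w \<delta>1 \<delta>2 :: real
  assumes "chi \<in> kernel_class"
    and "f \<in> bounded_log_uniformly_continuous"
    and "(x, y) \<in> quadrant"
    and "w > 0"
    and "\<delta>1 > 0" and "\<delta>2 > 0"
  shows "\<bar>kantorovich_series chi w f (x, y) - f (x, y)\<bar>
    \<le> log_modulus f \<delta>1 \<delta>2 *
        (enn2real (abs_moment_order 0 chi) *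
           (1 + 1 / (2 * \<delta>1 * w) + 1 / (2 * \<delta>2 * w) + 1 / (4 * \<delta>1 * \<delta>2 * w\<^sup>2))
         + enn2real (abs_moment 1 0 chi) / (\<delta>1 * w) * (1 + 1 / (2 * w * \<delta>2)))
      + log_modulus f \<delta>1 \<delta>2 *
        (enn2real (abs_moment 0 1 chi) / (\<delta>2 * w) * (1 + 1 / (2 * w * \<delta>1))
         + enn2real (abs_moment 1 1 chi) / (\<delta>1 * \<delta>2 * w\<^sup>2))"
proof -
  define W where "W = log_modulus f \<delta>1 \<delta>2"
  define A B where "A = 1 + 1 / (2 * \<delta>1 * w)" and "B = 1 + 1 / (2 * \<delta>2 * w)"
  define D1 D2 where "D1 = 1 / (\<delta>1 * w)" and "D2 = 1 / (\<delta>2 * w)"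
  define X Y where "X = x powr w" and "Y = y powr w"
  have f: "bounded (f ` quadrant)" "log_uniformly_continuous f"
    using assms(2) by (auto simp: bounded_log_uniformly_continuous_def)
  have W: "0 \<le> W" using f assms(5,6) by (simp add: W_def log_modulus_nonneg)
  have nonneg: "0 \<le> A" "0 \<le> B" "0 \<le> D1" "0 \<le> D2"
    using assms(4-6) by (simp_all add: A_def B_def D1_def D2_def)
  have xy: "x > 0" "y > 0" using assms(3) by (auto simp: quadrant_def)
  have XY: "(X, Y) \<in> quadrant" and lnX: "ln X = w * ln x" and lnY: "ln Y = w * ln y"
    using xy by (auto simp: X_def Y_def quadrant_def ln_powr)

  let ?chi = "\<lambda>(k::int, j::int). chi (exp (- of_int k) * X, exp (- of_int j) * Y)"
  let ?term = "\<lambda>(k, j). kantorovich_term chi w f x y k j"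
  obtain m00 where m00: "((\<lambda>(k, j). moment_term chi 0 0 X Y k j) has_sum m00) UNIV"
      "m00 \<le> enn2real (abs_moment 0 0 chi)"
    by (rule moment_has_sum_le[OF assms(1) _ XY, of 0 0]) auto
  obtain m10 where m10: "((\<lambda>(k, j). moment_term chi 1 0 X Y k j) has_sum m10) UNIV"
      "m10 \<le> enn2real (abs_moment 1 0 chi)"
    by (rule moment_has_sum_le[OF assms(1) _ XY, of 1 0]) auto
  obtain m01 where m01: "((\<lambda>(k, j). moment_term chi 0 1 X Y k j) has_sum m01) UNIV"
      "m01 \<le> enn2real (abs_moment 0 1 chi)"
    by (rule moment_has_sum_le[OF assms(1) _ XY, of 0 1]) auto
  obtain m11 where m11: "((\<lambda>(k, j). moment_term chi 1 1 X Y k j) has_sum m11) UNIV"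
      "m11 \<le> enn2real (abs_moment 1 1 chi)"
    by (rule moment_has_sum_le[OF assms(1) _ XY, of 1 1]) auto

  \<comment> \<open>The majorant is the expansion of \<open>W * (A + p1 * D1) * (B + p2 * D2)\<close>, weighted by the
    absolute kernel value, where \<open>p1\<close> and \<open>p2\<close> are the coordinatewise distances of \<open>(k, j)\<close> from \<open>(ln X, ln Y)\<close>.\<close>
  let ?maj = "\<lambda>p. W * (A * B * (case p of (k, j) \<Rightarrow> moment_term chi 0 0 X Y k j)
      + B * D1 * (case p of (k, j) \<Rightarrow> moment_term chi 1 0 X Y k j)
      + A * D2 * (case p of (k, j) \<Rightarrow> moment_term chi 0 1 X Y k j)
      + D1 * D2 * (case p of (k, j) \<Rightarrow> moment_term chi 1 1 X Y k j))"
  let ?M = "\<lambda>n00 n10 n01 n11. W * (A * B * n00 + B * D1 * n10 + A * D2 * n01 + D1 * D2 * n11)"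
  have maj_sum: "(?maj has_sum ?M m00 m10 m01 m11) UNIV"
    by (intro has_sum_cmult_right has_sum_add m00 m10 m01 m11)

  have "(?chi has_sum 1) UNIV"
    using assms(1) XY by (auto simp: kernel_class_def)
  from has_sum_cmult_left[OF this, of "- f (x, y)"]
  have chi_sum: "((\<lambda>p. - (?chi p * f (x, y))) has_sum - f (x, y)) UNIV" by simp
  have "(?term has_sum kantorovich_series chi w f (x, y)) UNIV"
    using kantorovich_summable[OF assms(1) f(1) assms(4,3)]
    by (simp add: kantorovich_series_def)
  from has_sum_add[OF this chi_sum]
  have diff_sum: "((\<lambda>p. ?term p - ?chi p * f (x, y)) has_sum
      (kantorovich_series chi w f (x, y) - f (x, y))) UNIV" by simp

  have pointwise: "\<bar>?term p - ?chi p * f (x, y)\<bar> \<le> ?maj p" for p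
  proof (cases p)
    case (Pair k j)
    define c where "c = \<bar>chi (exp (- of_int k) * X, exp (- of_int j) * Y)\<bar>"
    define I where "I = w\<^sup>2 * (LINT u:{of_int k / w..(of_int k + 1) / w}|lebesgue.
              (LINT v:{of_int j / w..(of_int j + 1) / w}|lebesgue. f (exp u, exp v)))"
    define p1 p2 where "p1 = \<bar>of_int k - w * ln x\<bar>" and "p2 = \<bar>of_int j - w * ln y\<bar>"
    have "\<bar>f (exp s, exp t) - f (x, y)\<bar> \<le> W * (1 + \<bar>s - ln x\<bar> / \<delta>1) * (1 + \<bar>t - ln y\<bar> / \<delta>2)" for s t
      using log_modulus_dilation[OF f(1) assms(5,6), of s t "ln x" "ln y"] xy by (simp add: W_def)
    then have dev: "\<bar>I - f (x, y)\<bar> \<le> W * (1 + (p1 + 1 / 2) / (\<delta>1 * w)) * (1 + (p2 + 1 / 2) / (\<delta>2 * w))"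
      unfolding I_def p1_def p2_def
      using iterated_cell_mean_deviation[OF log_uniformly_continuous_imp_continuous_exp[OF f(2)]
          assms(4-6) W, of "f (x, y)" "ln x" "ln y"]
      by simp
    have "?term p - ?chi p * f (x, y) = ?chi p * (I - f (x, y))"
      by (simp add: Pair kantorovich_term_def I_def X_def Y_def algebra_simps)
    then have "\<bar>?term p - ?chi p * f (x, y)\<bar> = c * \<bar>I - f (x, y)\<bar>"
      by (simp add: Pair c_def abs_mult)
    also have "\<dots> \<le> c * (W * (1 + (p1 + 1 / 2) / (\<delta>1 * w)) * (1 + (p2 + 1 / 2) / (\<delta>2 * w)))"
      by (intro mult_left_mono dev) (simp add: c_def)
    also have "\<dots> = c * (W * (A + p1 * D1) * (B + p2 * D2))"
    proof -
      have "1 + (p1 + 1 / 2) / (\<delta>1 * w) = A + p1 * D1" "1 + (p2 + 1 / 2) / (\<delta>2 * w) = B + p2 * D2"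
        by (simp_all add: A_def B_def D1_def D2_def add_divide_distrib)
      then show ?thesis by (simp only:)
    qed
    also have "\<dots> = ?M c (c * p1) (c * p2) (c * p1 * p2)"
      by (simp add: algebra_simps)
    also have "\<dots> = ?maj p"
      by (simp add: Pair moment_term_def c_def p1_def p2_def lnX lnY)
    finally show ?thesis .
  qed

  have maj_summable: "?maj summable_on UNIV" using maj_sum by (rule has_sum_imp_summable)
  then have norm_summable: "(\<lambda>p. norm (?term p - ?chi p * f (x, y))) summable_on UNIV"
    by (rule Infinite_Sum.abs_summable_on_comparison_test') (simp only: real_norm_def pointwise)
  have "\<bar>kantorovich_series chi w f (x, y) - f (x, y)\<bar>
      = norm (\<Sum>\<^sub>\<infinity>p. ?term p - ?chi p * f (x, y))"
    by (simp only: infsumI[OF diff_sum] real_norm_def)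
  also have "\<dots> \<le> (\<Sum>\<^sub>\<infinity>p. norm (?term p - ?chi p * f (x, y)))"
    using norm_summable by (rule norm_infsum_bound)
  also have "\<dots> \<le> (\<Sum>\<^sub>\<infinity>p. ?maj p)"
    using norm_summable maj_summable by (rule infsum_mono) (simp only: real_norm_def pointwise)
  also have "\<dots> = ?M m00 m10 m01 m11" using maj_sum by (rule infsumI)
  also have "\<dots> \<le> ?M (enn2real (abs_moment 0 0 chi)) (enn2real (abs_moment 1 0 chi))
      (enn2real (abs_moment 0 1 chi)) (enn2real (abs_moment 1 1 chi))"
    using m00 m10 m01 m11 W nonneg by (intro mult_left_mono add_mono) auto
  also have "\<dots> = W * (enn2real (abs_moment 0 0 chi) * (A * B) + enn2real (abs_moment 1 0 chi) * D1 * B)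
      + W * (enn2real (abs_moment 0 1 chi) * D2 * A + enn2real (abs_moment 1 1 chi) * (D1 * D2))"
    by (simp add: algebra_simps)
  finally have bound: "\<bar>kantorovich_series chi w f (x, y) - f (x, y)\<bar> \<le> \<dots>" .
  have "A * B = 1 + 1 / (2 * \<delta>1 * w) + 1 / (2 * \<delta>2 * w) + 1 / (4 * \<delta>1 * \<delta>2 * w\<^sup>2)"
    by (simp add: A_def B_def ring_distribs power2_eq_square mult_ac)
  moreover have "A = 1 + 1 / (2 * w * \<delta>1)" "B = 1 + 1 / (2 * w * \<delta>2)"
    by (simp_all add: A_def B_def mult_ac)
  moreover have "m * D1 = m / (\<delta>1 * w)" "m * D2 = m / (\<delta>2 * w)"
      "m * (D1 * D2) = m / (\<delta>1 * \<delta>2 * w\<^sup>2)" for m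
    by (simp_all add: D1_def D2_def power2_eq_square mult_ac)
  ultimately show ?thesis
    using bound by (simp only: W_def abs_moment_order_0)
qed

end
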